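(* Consider agents $i\in\mathcal N=\{1,\ldots,N\}$ with dynamics $\dot x_i(t)=u_i(t)$, $x_i(t),u_i(t)\in\mathbb R^2$, and their time-varying connectivity graph $G(t)=(\mathcal N,E(t))$ (with communication radius $r>0$ and hysteresis constant $\varepsilon\in(0,r)$). Assume that $G(t)$ is connected at $t=T_1$ and that agent $\ell\in\mathcal N$ is the fixed leader for all $t\ge T_1$, with fixed goal region $R_{\ell g}=\{y\in\mathbb R^2\mid\|y-c_{\ell g}\|\le r_{\ell g}\}$, $r_{\ell g}\ge r_{\min}>0$. Suppose every agent $i$ applies, for $t\ge T_1$, the controller $$u_i(t)=-b_i\,(x_i-c_{ig})-\sum_{j\in\mathcal N_i(t)}\frac{2r^2}{(r^2-\|x_{ij}\|^2)^2}\,(x_i-x_j),$$ where $b_\ell=1$ and $b_i=0$ for $i\ne\ell$. Then there exists $\overline t$ with $T_1\le\overline t<+\infty$ such that $$x_i(\overline t)\in R_{\ell g}\qquad\text{for all } i\in\mathcal N.$$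
   Context: There are $N$ agents $\mathcal N=\{1,\ldots,N\}$; $x_i(t)\in\mathbb R^2$ is the state (position) of agent $i$ at time $t$, with given initial state $x_i(0)$, and $x_{ij}(t)=x_i(t)-x_j(t)$. All agents have communication radius $r>0$, and $\varepsilon\in(0,r)$ is a given constant. Connectivity graph: $G(t)=(\mathcal N,E(t))$ is the undirected time-varying graph with $E(0)=\{(i,j)\mid \|x_i(0)-x_j(0)\|<r\}$ and, for $t>0$, $(i,j)\in E(t)$ if and only if either (i) $\|x_i(t)-x_j(t)\|\le r-\varepsilon$, or (ii) $r-\varepsilon<\|x_i(t)-x_j(t)\|\le r$ and $(i,j)\in E(t^-)$, where $t^-<t$ and $|t-t^-|\to 0$ (i.e. the edge was present immediately before $t$). The neighbour set of $i$ is $\mathcal N_i(t)=\{i'\in\mathcal N\mid (i,i')\in E(t)\}$. The interaction term of the controller is the gradient with respect to $x_i$ of the potential $\phi(\|x_{ij}\|)=\frac{\|x_{ij}\|^2}{r^2-\|x_{ij}\|^2}$, which is defined for $\|x_{ij}\|\in[0,r)$. The indicator $b_i\in\{0,1\}$ equals $1$ if and only if agent $i$ is the leader; $c_{\ell g}$ is the center of the leader's goal region. *)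

theory Defs
  imports "HOL-Analysis.Analysis"
begin

text \<open>
  Agents are the numbers in \<open>{1..N}\<close>, \<open>x i t\<close> is the position of agent \<open>i\<close> at time \<open>t\<close>, and \<open>E t\<close> is
  the edge set at time \<open>t\<close>.

  An edge being present immediately before \<open>t\<close> is expressed by the filter \<open>at_left t\<close>. The rule for
  \<open>t > 0\<close> alone does not fix \<open>E\<close>: as it only looks to the left of \<open>t\<close>, it is also
  satisfied by an edge that is present on \<open>(a, c]\<close> and absent on \<open>(c, b)\<close> for no reason while the
  distance stays in the hysteresis band \<open>(r - \<epsilon>, r]\<close>. The last conjunct excludes such jumps: within
  the band the status of a pair is kept. The interval is open at \<open>s\<close> because the distance enters
  the band from below at a time \<open>s\<close> with distance \<open>r - \<epsilon>\<close>.
\<close>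

definition connectivity_graph ::
  "nat \<Rightarrow> real \<Rightarrow> real \<Rightarrow> (nat \<Rightarrow> real \<Rightarrow> real^2) \<Rightarrow> (real \<Rightarrow> (nat \<times> nat) set) \<Rightarrow> bool" where
  "connectivity_graph N r \<epsilon> x E \<longleftrightarrow>
     (\<forall>t\<ge>0. E t \<subseteq> {1..N} \<times> {1..N}) \<and>
     (\<forall>i\<in>{1..N}. \<forall>j\<in>{1..N}.
        ((i, j) \<in> E 0 \<longleftrightarrow> norm (x i 0 - x j 0) < r) \<and>
        (\<forall>t>0. (i, j) \<in> E t \<longleftrightarrow>
           norm (x i t - x j t) \<le> r - \<epsilon> \<or>
           (r - \<epsilon> < norm (x i t - x j t) \<and> norm (x i t - x j t) \<le> r \<and>
            (\<forall>\<^sub>F s in at_left t. (i, j) \<in> E s))) \<and>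
        (\<forall>s t. 0 \<le> s \<and> s < t \<and>
           (\<forall>\<tau>\<in>{s<..t}. r - \<epsilon> < norm (x i \<tau> - x j \<tau>) \<and> norm (x i \<tau> - x j \<tau>) \<le> r) \<longrightarrow>
           ((i, j) \<in> E t \<longleftrightarrow> (i, j) \<in> E s)))"

definition neighbours :: "nat \<Rightarrow> (real \<Rightarrow> (nat \<times> nat) set) \<Rightarrow> nat \<Rightarrow> real \<Rightarrow> nat set" where
  "neighbours N E i t = {j \<in> {1..N}. (i, j) \<in> E t}"

definition graph_connected :: "nat \<Rightarrow> (nat \<times> nat) set \<Rightarrow> bool" where
  "graph_connected N F \<longleftrightarrow> (\<forall>i\<in>{1..N}. \<forall>j\<in>{1..N}. (i, j) \<in> F\<^sup>*)"

text \<open>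
  The right-hand side of the closed loop jumps whenever an edge appears, so \<open>x' = u\<close> is only
  required off a countable set of times; continuity of \<open>x\<close> makes this a genuine solution notion.
\<close>

definition single_integrator ::
  "nat \<Rightarrow> real \<Rightarrow> (nat \<Rightarrow> real \<Rightarrow> real^2) \<Rightarrow> (nat \<Rightarrow> real \<Rightarrow> real^2) \<Rightarrow> bool" where
  "single_integrator N T x u \<longleftrightarrow>
     (\<forall>i\<in>{1..N}. continuous_on {T..} (x i) \<and>
        (\<exists>S. countable S \<and>
           (\<forall>t\<in>{T..} - S. (x i has_vector_derivative u i t) (at t within {T..}))))"

text \<open>
  The sum is the gradient of \<open>\<Sum>j. \<phi> \<parallel>x i - x j\<parallel>\<close> with \<open>\<phi> d = d\<^sup>2 / (r\<^sup>2 - d\<^sup>2)\<close>, defined for \<open>0 \<le> d < r\<close>. At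
  \<open>d = r\<close> the gain has a pole, where division by zero yields \<open>0\<close>; the law is meaningful only while
  neighbours are at distance less than \<open>r\<close>.
\<close>

definition controller ::
  "nat \<Rightarrow> real \<Rightarrow> (nat \<Rightarrow> real^2) \<Rightarrow> (nat \<Rightarrow> real) \<Rightarrow> (real \<Rightarrow> (nat \<times> nat) set) \<Rightarrow>
   (nat \<Rightarrow> real \<Rightarrow> real^2) \<Rightarrow> nat \<Rightarrow> real \<Rightarrow> real^2" where
  "controller N r c b E x i t =
     - (b i *\<^sub>R (x i t - c i)) -
     (\<Sum>j\<in>neighbours N E i t.
        (2 * r\<^sup>2 / (r\<^sup>2 - (norm (x i t - x j t))\<^sup>2)\<^sup>2) *\<^sub>R (x i t - x j t))"

text \<open>Every family of trajectories has a connectivity graph.\<close>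

lemma connectivity_graph_exists:
  assumes "0 < \<epsilon>" "\<epsilon> < r"
  shows "\<exists>E. connectivity_graph N r \<epsilon> x E"
proof -
  define d where "d i j t = norm (x i t - x j t)" for i j t
  define Q where "Q i j s \<longleftrightarrow> d i j s \<le> r - \<epsilon> \<or> s = 0 \<and> d i j 0 < r" for i j and s :: real
  define P where "P i j t \<longleftrightarrow> (\<exists>s\<in>{0..t}. Q i j s \<and>
      (\<forall>u\<in>{s..t}. d i j u \<le> r))" for i j and t :: real
  define E where "E t = {(i, j). i \<in> {1..N} \<and> j \<in> {1..N} \<and> P i j t}" for t
  have P0: "P i j 0 \<longleftrightarrow> d i j 0 < r" for i j
    using assms by (auto simp: P_def Q_def)
  have rule: "P i j t \<longleftrightarrow> d i j t \<le> r - \<epsilon> \<or>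
      (r - \<epsilon> < d i j t \<and> d i j t \<le> r \<and> (\<forall>\<^sub>F s in at_left t. P i j s))" (is "_ \<longleftrightarrow> ?R")
    if t: "t > 0" for i j t
  proof
    assume "P i j t"
    then obtain s where s: "0 \<le> s" "s \<le> t" "Q i j s"
      "\<And>u. s \<le> u \<Longrightarrow> u \<le> t \<Longrightarrow> d i j u \<le> r" by (auto simp: P_def)
    show ?R
    proof (cases "d i j t \<le> r - \<epsilon>")
      case False
      then have "s < t" using s t by (cases "s = t") (auto simp: Q_def)
      have "P i j u" if "s < u" "u < t" for u
        unfolding P_def using s that by (intro bexI[of _ s]) auto
      then have "\<forall>\<^sub>F u in at_left t. P i j u"
        using eventually_at_left_real[OF \<open>s < t\<close>] by (auto elim!: eventually_mono)
      then show ?thesis using False s by auto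
    qed simp
  next
    assume R: ?R
    show "P i j t"
    proof (cases "d i j t \<le> r - \<epsilon>")
      case True
      then show ?thesis unfolding P_def Q_def using t assms by (intro bexI[of _ t]) auto
    next
      case False
      with R have le: "d i j t \<le> r" and ev: "\<forall>\<^sub>F s in at_left t. P i j s" by auto
      from ev obtain b where b: "b < t" "\<And>y. b < y \<Longrightarrow> y < t \<Longrightarrow> P i j y"
        unfolding eventually_at_left_field by blast
      obtain m where m: "b < m" "m < t" using b dense by blast
      from b(2)[OF m] obtain s where s: "0 \<le> s" "s \<le> m"
        "Q i j s"
        "\<And>u. s \<le> u \<Longrightarrow> u \<le> m \<Longrightarrow> d i j u \<le> r" by (auto simp: P_def)
      have "d i j u \<le> r" if "m \<le> u" "u < t" for u
        using b(2)[of u] that m by (auto simp: P_def)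
      then have "d i j u \<le> r" if "s \<le> u" "u \<le> t" for u
        using that s(4) le by (cases "u \<le> m"; cases "u = t") auto
      then show ?thesis unfolding P_def using s m by (intro bexI[of _ s]) auto
    qed
  qed
  have keep: "P i j t \<longleftrightarrow> P i j s"
    if st: "0 \<le> s" "s < t" and band: "\<And>\<tau>. \<tau> \<in> {s<..t} \<Longrightarrow> r - \<epsilon> < d i j \<tau> \<and> d i j \<tau> \<le> r"
    for i j s t
  proof
    assume "P i j t"
    then obtain a where a: "0 \<le> a" "a \<le> t" "Q i j a"
      "\<And>u. a \<le> u \<Longrightarrow> u \<le> t \<Longrightarrow> d i j u \<le> r" by (auto simp: P_def)
    have "a \<le> s" using a st band[of a] by (force simp: Q_def)
    then show "P i j s" unfolding P_def using a st by (intro bexI[of _ a]) auto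
  next
    assume "P i j s"
    then obtain a where a: "0 \<le> a" "a \<le> s" "Q i j a"
      "\<And>u. a \<le> u \<Longrightarrow> u \<le> s \<Longrightarrow> d i j u \<le> r" by (auto simp: P_def)
    have "d i j u \<le> r" if "a \<le> u" "u \<le> t" for u
      using a(4)[of u] band[of u] that by (cases "u \<le> s") auto
    then show "P i j t" unfolding P_def using a st by (intro bexI[of _ a]) auto
  qed
  have "connectivity_graph N r \<epsilon> x E"
    unfolding connectivity_graph_def d_def[symmetric]
    using P0 rule keep by (auto simp: E_def)
  then show ?thesis by blast
qed

end

theory Submission
  imports Defs
begin

text \<open>
  The potential \<open>\<parallel>x l - c l\<parallel>\<^sup>2 + \<Sum>(i,j)\<in>F. \<phi> \<parallel>x i - x j\<parallel>\<close> of a fixed edge set \<open>F\<close> decreases while the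
  graph equals \<open>F\<close> and blows up when an edge of \<open>F\<close> reaches length \<open>r\<close>. So no edge is ever lost,
  the graph changes finitely often, and every edge of \<open>E T1\<close> survives. The interaction gains are at
  least \<open>2 / r\<^sup>2\<close> and symmetric, hence \<open>\<Sum>i. \<parallel>x i - c l\<parallel>\<^sup>2\<close> decreases at a rate bounded below by a constant
  multiple of \<open>\<parallel>x l - c l\<parallel>\<^sup>2 + \<Sum>(i,j)\<in>E T1. \<parallel>x i - x j\<parallel>\<^sup>2\<close>. This quantity is therefore small at some
  time, and then, along paths of the connected graph \<open>E T1\<close>, every agent is close to \<open>c l\<close>.
\<close>

section \<open>Monotonicity from derivatives off a countable set\<close>

text \<open>Zygmund's argument: a value \<open>y\<close> strictly between \<open>f a\<close> and \<open>f b\<close> can be chosen outside the countable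
  set \<open>f ` S\<close>, and at the last time with \<open>f s \<le> y\<close> the derivative cannot be negative.\<close>

lemma nonincreasing_of_derivative_neg:
  fixes f :: "real \<Rightarrow> real"
  assumes "countable S" "a \<le> b" and cont: "continuous_on {a..b} f"
    and deriv: "\<And>t. t \<in> {a..b} - S \<Longrightarrow> (f has_real_derivative f' t) (at t within {a..b})"
    and neg: "\<And>t. t \<in> {a..b} - S \<Longrightarrow> f' t < 0"
  shows "f b \<le> f a"
proof (rule ccontr)
  assume "\<not> f b \<le> f a"
  then have "uncountable ({f a<..<f b} - f ` S)"
    using assms(1) by (intro uncountable_minus_countable) (auto simp: uncountable_open_interval)
  then obtain y where y: "f a < y" "y < f b" "y \<notin> f ` S"
    by (metis Diff_iff all_not_in_conv countable_empty greaterThanLessThan_iff)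
  define K where "K = {t\<in>{a..b}. f t \<in> {..y}}"
  have "closed K" unfolding K_def
    using continuous_closed_preimage[OF cont, of "{..y}"] by (simp add: Int_def vimage_def)
  then have "compact K" by (auto simp: K_def compact_eq_bounded_closed
        intro: bounded_subset[OF bounded_closed_interval[of a b]])
  then obtain s where s: "s \<in> K" "\<And>t. t \<in> K \<Longrightarrow> t \<le> s"
    using compact_attains_sup[of K] y(1) assms(2) by (force simp: K_def)
  have sb: "a \<le> s" "s < b" "f s \<le> y" using s(1) y by (auto simp: K_def less_le)
  have above: "y < f t" if "s < t" "t \<le> b" for t
    using s(2)[of t] that sb by (force simp: K_def)
  obtain t where t: "s \<le> t" "t \<le> b" "f t = y"
    using IVT'[of f s y b] sb y(2) continuous_on_subset[OF cont, of "{s..b}"] by auto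
  then have "f s = y" using above[of t] by (cases "s = t") auto
  \<comment> \<open>\<open>y\<close> avoids the image of \<open>S\<close>, so \<open>f s = y\<close>
    keeps \<open>s\<close> off the exceptional set and the derivative at \<open>s\<close> is
    available.\<close>
  then have sS: "s \<in> {a..b} - S" using y(3) sb by auto
  from has_real_derivative_neg_dec_right[OF deriv[OF sS] neg[OF sS]]
  obtain e where e: "e > 0" "\<And>h. 0 < h \<Longrightarrow> s + h \<in> {a..b} \<Longrightarrow> h < e \<Longrightarrow> f (s + h) < f s"
    by auto
  define h where "h = min (e / 2) (b - s)"
  have "0 < h" "h < e" "s + h \<le> b" using e(1) sb by (auto simp: h_def)
  then show False using e(2)[of h] above[of "s + h"] sb \<open>f s = y\<close> by force
qed

text \<open>Subtracting a line of slope \<open>k + e\<close> makes the derivative strictly negative,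
  so the previous lemma applies; then \<open>e\<close> tends to 0.\<close>

lemma increment_le_of_derivative_le:
  fixes f :: "real \<Rightarrow> real"
  assumes "countable S" "a \<le> b" "continuous_on {a..b} f"
    and "\<And>t. t \<in> {a..b} - S \<Longrightarrow> (f has_real_derivative f' t) (at t within {a..b})"
    and "\<And>t. t \<in> {a..b} - S \<Longrightarrow> f' t \<le> k"
  shows "f b - f a \<le> k * (b - a)"
proof -
  have "f b - f a \<le> k * (b - a) + e * (b - a)" if "0 < e" for e
  proof -
    have "f b - (k + e) * b \<le> f a - (k + e) * a"
    proof (rule nonincreasing_of_derivative_neg[OF assms(1,2), where f' = "\<lambda>t. f' t - (k + e)"])
      show "continuous_on {a..b} (\<lambda>t. f t - (k + e) * t)"
        by (intro continuous_intros assms(3))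
      fix t assume t: "t \<in> {a..b} - S"
      show "((\<lambda>t. f t - (k + e) * t) has_real_derivative f' t - (k + e)) (at t within {a..b})"
        using assms(4)[OF t] by (auto intro!: derivative_eq_intros)
      show "f' t - (k + e) < 0" using assms(5)[OF t] that by simp
    qed
    then show ?thesis by (simp add: algebra_simps)
  qed
  note le = this
  show ?thesis
  proof (cases "a = b")
    case False
    show ?thesis
    proof (rule field_le_epsilon)
      fix \<delta> :: real assume "0 < \<delta>"
      then show "f b - f a \<le> k * (b - a) + \<delta>"
        using le[of "\<delta> / (b - a)"] assms(2) False by simp
    qed
  qed simp
qed

section \<open>Last times, symmetric double sums and walks\<close>

text \<open>The time \<open>\<sigma>\<close> is the supremum of the times satisfying
  \<open>P\<close>. \<open>P\<close> will be the status of an edge, which need not behave well at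
  the supremum, hence the alternative: either \<open>P\<close> holds there, or times with
  \<open>P\<close> accumulate from the left.\<close>

lemma last_time:
  fixes s t :: real
  assumes "P s" "s \<le> t"
  obtains \<sigma> where "s \<le> \<sigma>" "\<sigma> \<le> t" "\<And>u. \<sigma> < u \<Longrightarrow> u \<le> t \<Longrightarrow> \<not> P u"
    "P \<sigma> \<or> s < \<sigma> \<and> (\<forall>b<\<sigma>. \<exists>a. b < a \<and> s \<le> a \<and> a < \<sigma> \<and> P a)"
proof -
  define A where "A = {u\<in>{s..t}. P u}"
  have A: "s \<in> A" "bdd_above A" using assms by (auto simp: A_def)
  have up: "u \<le> Sup A" if "s \<le> u" "u \<le> t" "P u" for u
    using that A(2) by (intro cSup_upper) (auto simp: A_def)
  have le: "Sup A \<le> t" using A(1) by (intro cSup_least) (auto simp: A_def)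
  have "s < Sup A" "\<exists>a. b < a \<and> s \<le> a \<and> a < Sup A \<and> P a" 
    if n: "\<not> P (Sup A)" and "b < Sup A" for b
  proof -
    show "s < Sup A" using up[of s] assms n by (cases "s = Sup A") auto
    obtain a where a: "a \<in> A" "b < a" using less_cSup_iff[of A b] A \<open>b < Sup A\<close> by blast
    then have "a \<noteq> Sup A" "s \<le> a" "P a" "a \<le> Sup A" using n up by (auto simp: A_def)
    then show "\<exists>a. b < a \<and> s \<le> a \<and> a < Sup A \<and> P a" using a by (intro exI[of _ a]) auto
  qed
  note * = this
  have "P (Sup A) \<or> s < Sup A \<and> (\<forall>b<Sup A. \<exists>a. b < a \<and> s \<le> a \<and> a < Sup A \<and> P a)"
    using *(1)[of "Sup A - 1"] *(2) by auto
  moreover have "\<not> P u" if "Sup A < u" "u \<le> t" for u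
    using up[of u] up[of s] assms that by force
  ultimately show ?thesis using that[of "Sup A"] up[of s] assms le by blast
qed

text \<open>Discrete integration by parts for the weighted graph Laplacian: renaming
  \<open>i\<close> and \<open>j\<close> turns the \<open>v j\<close> half into a second copy of the
  \<open>v i\<close> half.\<close>

lemma sum_symmetrize:
  fixes z v :: "nat \<Rightarrow> 'a::real_inner" and w :: "nat \<Rightarrow> nat \<Rightarrow> real"
  assumes "\<And>i j. i \<in> I \<Longrightarrow> j \<in> I \<Longrightarrow> w i j = w j i"
  shows "(\<Sum>i\<in>I. \<Sum>j\<in>I. w i j * ((z i - z j) \<bullet> (v i - v j))) =
     2 * (\<Sum>i\<in>I. (\<Sum>j\<in>I. w i j *\<^sub>R (z i - z j)) \<bullet> v i)"
proof -
  have "(\<Sum>i\<in>I. \<Sum>j\<in>I. w i j * ((z i - z j) \<bullet> v j)) =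
      (\<Sum>i\<in>I. \<Sum>j\<in>I. w j i * ((z j - z i) \<bullet> v i))"
    by (rule sum.swap)
  also have "\<dots> = (\<Sum>i\<in>I. \<Sum>j\<in>I. - (w i j * ((z i - z j) \<bullet> v i)))"
    using assms by (intro sum.cong refl) (simp add: algebra_simps)
  finally show ?thesis
    by (simp add: inner_diff_right right_diff_distrib sum_subtractf sum_negf inner_sum_left)
qed

lemma relpow_norm_le:
  assumes "\<And>i j. (i, j) \<in> F \<Longrightarrow> norm (z i - z j :: 'a::real_normed_vector) \<le> s"
    and "(i, j) \<in> F ^^ n"
  shows "norm (z i - z j) \<le> real n * s"
  using assms(2)
proof (induction n arbitrary: j)
  case (Suc n)
  then obtain k where k: "(i, k) \<in> F ^^ n" "(k, j) \<in> F" by auto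
  have "norm (z i - z j) \<le> norm (z i - z k) + norm (z k - z j)"
    using norm_triangle_ineq[of "z i - z k" "z k - z j"] by simp
  also have "\<dots> \<le> real n * s + s" using Suc.IH[OF k(1)] assms(1)[OF k(2)] by linarith
  finally show ?case by (simp add: algebra_simps)
qed simp

section \<open>Evolution of the hysteresis graph\<close>

text \<open>Continuity is assumed from time 0 because the status of an edge in the band depends on
  its history, which \<open>edge_sym\<close> follows back to time 0.\<close>

locale hysteresis_graph =
  fixes N :: nat and r \<epsilon> :: real and x :: "nat \<Rightarrow> real \<Rightarrow> real^2"
    and E :: "real \<Rightarrow> (nat \<times> nat) set"
  assumes eps: "0 < \<epsilon>" "\<epsilon> < r"
    and cont: "i \<in> {1..N} \<Longrightarrow> continuous_on {0..} (x i)"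
    and graph: "connectivity_graph N r \<epsilon> x E"
begin

definition d :: "nat \<Rightarrow> nat \<Rightarrow> real \<Rightarrow> real" where
  "d i j t = norm (x i t - x j t)"

lemma d_commute: "d i j t = d j i t"
  by (simp add: d_def norm_minus_commute)

lemma d_continuous: "i \<in> {1..N} \<Longrightarrow> j \<in> {1..N} \<Longrightarrow> continuous_on {0..} (d i j)"
  unfolding d_def using cont by (intro continuous_intros) auto

lemma edge_subset: "0 \<le> t \<Longrightarrow> E t \<subseteq> {1..N} \<times> {1..N}"
  using graph by (auto simp: connectivity_graph_def)

context
  fixes i j assumes ij: "i \<in> {1..N}" "j \<in> {1..N}"
begin

lemma edge_0: "(i, j) \<in> E 0 \<longleftrightarrow> d i j 0 < r"
  using graph ij by (auto simp: connectivity_graph_def d_def)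

lemma edge_iff: "0 < t \<Longrightarrow> (i, j) \<in> E t \<longleftrightarrow> d i j t \<le> r - \<epsilon> \<or>
    (r - \<epsilon> < d i j t \<and> d i j t \<le> r \<and> (\<forall>\<^sub>F s in at_left t. (i, j) \<in> E s))"
  using graph ij by (simp add: connectivity_graph_def d_def)

lemma edge_keep: "0 \<le> s \<Longrightarrow> s < t \<Longrightarrow>
    (\<And>u. s < u \<Longrightarrow> u \<le> t \<Longrightarrow> r - \<epsilon> < d i j u \<and> d i j u \<le> r) \<Longrightarrow> (i, j) \<in> E t \<longleftrightarrow> (i, j) \<in> E s"
  using graph ij unfolding connectivity_graph_def d_def by (meson greaterThanAtMost_iff)

lemma edge_le: "0 \<le> t \<Longrightarrow> (i, j) \<in> E t \<Longrightarrow> d i j t \<le> r"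
  using edge_0 edge_iff[of t] eps by (cases "t = 0") auto

lemma edge_near: "0 \<le> t \<Longrightarrow> d i j t \<le> r - \<epsilon> \<Longrightarrow> (i, j) \<in> E t"
  using edge_0 edge_iff[of t] eps by (cases "t = 0") auto

text \<open>Consider the last time \<open>\<sigma>\<close> of absence. If the edge is absent at
  \<open>\<sigma>\<close>, its presence afterwards bounds the distance by \<open>r\<close>, so the
  pair stays in the band and \<open>edge_keep\<close> applies. If it is present at
  \<open>\<sigma>\<close>, the hysteresis clause makes it present just before, against the
  accumulation of absences.\<close>

lemma nonedge_persists:
  assumes "0 \<le> s" "s \<le> t" "(i, j) \<notin> E s" "\<And>u. s < u \<Longrightarrow> u \<le> t \<Longrightarrow> r - \<epsilon> < d i j u"
  shows "(i, j) \<notin> E t"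
proof
  assume t: "(i, j) \<in> E t"
  obtain \<sigma> where \<sigma>: "s \<le> \<sigma>" "\<sigma> \<le> t" and after: "\<And>u. \<sigma> < u \<Longrightarrow> u \<le> t \<Longrightarrow> (i, j) \<in> E u"
    and lim: "(i, j) \<notin> E \<sigma> \<or> s < \<sigma> \<and> (\<forall>b<\<sigma>. \<exists>a. b < a \<and> s \<le> a \<and> a < \<sigma> \<and> (i, j) \<notin> E a)"
    by (rule last_time[of "\<lambda>u. (i, j) \<notin> E u" s t, OF assms(3,2)], rule that) auto
  show False
  proof (cases "(i, j) \<in> E \<sigma>")
    case False
    then have "\<sigma> < t" using t \<sigma> by (cases "\<sigma> = t") auto
    have "(i, j) \<in> E t \<longleftrightarrow> (i, j) \<in> E \<sigma>"
    proof (rule edge_keep)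
      show "0 \<le> \<sigma>" "\<sigma> < t" using assms(1) \<sigma> \<open>\<sigma> < t\<close> by auto
      show "r - \<epsilon> < d i j u \<and> d i j u \<le> r" if "\<sigma> < u" "u \<le> t" for u
        using assms(1) assms(4)[of u] edge_le[of u] after[OF that] \<sigma> that by simp
    qed
    then show False using t False by simp
  next
    case True
    with lim have "s < \<sigma>" and lim: "\<And>b. b < \<sigma> \<Longrightarrow> \<exists>a. b < a \<and> s \<le> a \<and> a < \<sigma> \<and> (i, j) \<notin> E a"
      by auto
    have "\<forall>\<^sub>F u in at_left \<sigma>. (i, j) \<in> E u"
      using True edge_iff[of \<sigma>] assms(1) assms(4)[of \<sigma>] \<open>s < \<sigma>\<close> \<sigma> by simp
    then obtain b where "b < \<sigma>" "\<And>y. b < y \<Longrightarrow> y < \<sigma> \<Longrightarrow> (i, j) \<in> E y"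
      unfolding eventually_at_left_field by blast
    then show False using lim by blast
  qed
qed

text \<open>Dual argument with the last time \<open>\<sigma>\<close> of presence: absence afterwards
  forces distance above \<open>r - \<epsilon>\<close>. If the edge is already absent at
  \<open>\<sigma>\<close>, continuity extends that lower bound to the left of
  \<open>\<sigma>\<close>, and \<open>edge_keep\<close> carries presence from a nearby earlier time
  to \<open>\<sigma>\<close>.\<close>

lemma edge_persists:
  assumes "0 \<le> s" "s \<le> t" "(i, j) \<in> E s" "\<And>u. s < u \<Longrightarrow> u \<le> t \<Longrightarrow> d i j u \<le> r"
  shows "(i, j) \<in> E t"
proof (rule ccontr)
  assume t: "(i, j) \<notin> E t"
  obtain \<sigma> where \<sigma>: "s \<le> \<sigma>" "\<sigma> \<le> t" and after: "\<And>u. \<sigma> < u \<Longrightarrow> u \<le> t \<Longrightarrow> (i, j) \<notin> E u"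
    and lim: "(i, j) \<in> E \<sigma> \<or> s < \<sigma> \<and> (\<forall>b<\<sigma>. \<exists>a. b < a \<and> s \<le> a \<and> a < \<sigma> \<and> (i, j) \<in> E a)"
    by (rule last_time[of "\<lambda>u. (i, j) \<in> E u" s t, OF assms(3,2)], rule that) auto
  show False
  proof (cases "(i, j) \<in> E \<sigma>")
    case True
    then have "\<sigma> < t" using t \<sigma> by (cases "\<sigma> = t") auto
    have "(i, j) \<in> E t \<longleftrightarrow> (i, j) \<in> E \<sigma>"
    proof (rule edge_keep)
      show "0 \<le> \<sigma>" "\<sigma> < t" using assms(1) \<sigma> \<open>\<sigma> < t\<close> by auto
      show "r - \<epsilon> < d i j u \<and> d i j u \<le> r" if "\<sigma> < u" "u \<le> t" for u
        using assms(1) assms(4)[of u] edge_near[of u] after[OF that] \<sigma> that by force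
    qed
    then show False using t True by simp
  next
    case False
    with lim have "s < \<sigma>" and lim: "\<And>b. b < \<sigma> \<Longrightarrow> \<exists>a. b < a \<and> s \<le> a \<and> a < \<sigma> \<and> (i, j) \<in> E a"
      by auto
    have far: "r - \<epsilon> < d i j \<sigma>" using False edge_near[of \<sigma>] assms(1) \<sigma> by force
    have "isCont (d i j) \<sigma>"
      using d_continuous[OF ij] assms(1) \<open>s < \<sigma>\<close> by (intro continuous_on_interior[of "{0..}"]) auto
    then have "(d i j \<longlongrightarrow> d i j \<sigma>) (at_left \<sigma>)"
      by (simp add: continuous_within filterlim_at_split isCont_def)
    then have "\<forall>\<^sub>F u in at_left \<sigma>. r - \<epsilon> < d i j u"
      using far by (rule order_tendstoD)
    then obtain b where b: "b < \<sigma>" "\<And>y. b < y \<Longrightarrow> y < \<sigma> \<Longrightarrow> r - \<epsilon> < d i j y"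
      unfolding eventually_at_left_field by blast
    obtain a where a: "b < a" "s \<le> a" "a < \<sigma>" "(i, j) \<in> E a" using lim[OF b(1)] by blast
    have "(i, j) \<in> E \<sigma> \<longleftrightarrow> (i, j) \<in> E a"
    proof (rule edge_keep)
      show "0 \<le> a" "a < \<sigma>" using a assms(1) by auto
      show "r - \<epsilon> < d i j u \<and> d i j u \<le> r" if "a < u" "u \<le> \<sigma>" for u
        using that a b(2)[of u] far assms(4)[of u] \<sigma> by (cases "u = \<sigma>") auto
    qed
    then show False using a False by simp
  qed
qed

end

text \<open>The edge rule is stated for ordered pairs, so symmetry is a property of its solutions. An edge
  traces back to the last time at which the distance was at most \<open>r - \<epsilon>\<close>, or to time \<open>0\<close>, and there
  both orientations are present.\<close>

lemma edge_sym:
  assumes ij: "i \<in> {1..N}" "j \<in> {1..N}" and "0 \<le> t" and e: "(i, j) \<in> E t"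
  shows "(j, i) \<in> E t"
proof -
  have "\<exists>s. 0 \<le> s \<and> s \<le> t \<and> (j, i) \<in> E s \<and> (\<forall>u. s < u \<and> u \<le> t \<longrightarrow> r - \<epsilon> < d i j u)"
  proof (cases "\<exists>s\<in>{0..t}. d i j s \<le> r - \<epsilon>")
    case True
    define K where "K = {s\<in>{0..t}. d i j s \<in> {..r - \<epsilon>}}"
    have "closed K" unfolding K_def
      using continuous_closed_preimage[OF continuous_on_subset[OF d_continuous[OF ij]],
          of "{0..t}" "{..r - \<epsilon>}"] by (simp add: Int_def vimage_def)
    then have "compact K" by (auto simp: K_def compact_eq_bounded_closed
          intro: bounded_subset[OF bounded_closed_interval[of 0 t]])
    moreover have "K \<noteq> {}" using True by (auto simp: K_def)
    ultimately obtain s where s: "s \<in> K" "\<And>u. u \<in> K \<Longrightarrow> u \<le> s"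
      using compact_attains_sup[of K] by blast
    then have "(j, i) \<in> E s" using edge_near[OF ij(2,1), of s] by (auto simp: K_def d_commute)
    moreover have "r - \<epsilon> < d i j u" if "s < u" "u \<le> t" for u
      using s(2)[of u] s(1) that by (force simp: K_def)
    ultimately show ?thesis using s(1) by (auto simp: K_def)
  next
    case False
    then have far: "r - \<epsilon> < d i j u" if "0 < u" "u \<le> t" for u
      using that by (meson atLeastAtMost_iff less_imp_le not_le)
    have "(i, j) \<in> E 0" using nonedge_persists[OF ij order_refl assms(3)] e far by blast
    then have "(j, i) \<in> E 0" using edge_0[OF ij] edge_0[OF ij(2,1)] by (simp add: d_commute)
    then show ?thesis using far assms(3) by blast
  qed
  then obtain s where s: "0 \<le> s" "s \<le> t" "(j, i) \<in> E s"
    "\<And>u. s < u \<Longrightarrow> u \<le> t \<Longrightarrow> r - \<epsilon> < d i j u" by auto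
  show ?thesis
  proof (rule edge_persists[OF ij(2,1) s(1,2,3)])
    fix u assume u: "s < u" "u \<le> t"
    \<comment> \<open>Had \<open>(i, j)\<close> been absent at \<open>u\<close>, it would have
      stayed absent until \<open>t\<close>; its presence gives the distance bound that the reversed
      edge needs.\<close>
    have "(i, j) \<in> E u" using nonedge_persists[OF ij, of u t] e s u by force
    then show "d j i u \<le> r" using edge_le[OF ij, of u] s u by (simp add: d_commute)
  qed
qed

text \<open>Edges have distance below \<open>r\<close> and non-edges distance above
  \<open>r - \<epsilon>\<close>. Both are open conditions, so by continuity they last for a short
  while, uniformly over the finitely many pairs, and the two persistence lemmas apply.\<close>

lemma edge_const_right:
  assumes "0 \<le> t" "\<forall>(i, j)\<in>E t. d i j t < r"
  shows "\<forall>\<^sub>F s in at_right t. E s = E t \<and> (\<forall>(i, j)\<in>E s. d i j s < r)"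
proof -
  have lim: "(d i j \<longlongrightarrow> d i j t) (at_right t)" if "i \<in> {1..N}" "j \<in> {1..N}" for i j
  proof -
    have "continuous (at t within {0..}) (d i j)"
      using d_continuous[OF that] assms(1) by (simp add: continuous_on_eq_continuous_within)
    then have "continuous (at_right t) (d i j)"
      by (rule continuous_within_subset) (use assms in auto)
    then show ?thesis by (simp add: continuous_within)
  qed
  have "\<forall>\<^sub>F s in at_right t. \<forall>p\<in>{1..N}\<times>{1..N}.
      (p \<in> E t \<longrightarrow> p \<in> E s \<and> d (fst p) (snd p) s < r) \<and> (p \<notin> E t \<longrightarrow> p \<notin> E s)"
  proof (intro eventually_ball_finite ballI)
    fix p assume "p \<in> {1..N} \<times> {1..N}"
    then obtain i j where p: "p = (i, j)" and ij: "i \<in> {1..N}" "j \<in> {1..N}" by auto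
    show "\<forall>\<^sub>F s in at_right t.
      (p \<in> E t \<longrightarrow> p \<in> E s \<and> d (fst p) (snd p) s < r) \<and> (p \<notin> E t \<longrightarrow> p \<notin> E s)"
    proof (cases "p \<in> E t")
      case True
      then have "d i j t < r" using assms p by auto
      then have "\<forall>\<^sub>F s in at_right t. d i j s < r"
        using lim[OF ij] by (rule order_tendstoD(2)[rotated])
      then obtain b where b: "t < b" "\<And>y. t < y \<Longrightarrow> y < b \<Longrightarrow> d i j y < r"
        unfolding eventually_at_right_field by blast
      have "p \<in> E s \<and> d i j s < r" if "t < s" "s < b" for s
        using edge_persists[OF ij, of t s] True p b(2) that assms by (simp add: less_imp_le)
      then show ?thesis using True b unfolding eventually_at_right_field by (auto simp: p)
    next
      case False
      then have "r - \<epsilon> < d i j t" using edge_near[OF ij, of t] assms p by force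
      then have "\<forall>\<^sub>F s in at_right t. r - \<epsilon> < d i j s"
        using lim[OF ij] by (rule order_tendstoD(1)[rotated])
      then obtain b where b: "t < b" "\<And>y. t < y \<Longrightarrow> y < b \<Longrightarrow> r - \<epsilon> < d i j y"
        unfolding eventually_at_right_field by blast
      have "p \<notin> E s" if "t < s" "s < b" for s
        using nonedge_persists[OF ij, of t s] False p b(2) that assms by simp
      then show ?thesis using False b unfolding eventually_at_right_field by (auto simp: p)
    qed
  qed auto
  moreover have "\<forall>\<^sub>F s in at_right t. t < s" by (simp add: eventually_at_right_less)
  ultimately show ?thesis
  proof eventually_elim
    case (elim s)
    then have "E s = E t" using edge_subset[of s] edge_subset[of t] assms(1) by fastforce
    then show ?case using elim(1) edge_subset[of t] assms(1) by fastforce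
  qed
qed

end

section \<open>The closed-loop dynamics\<close>

lemma norm_sq_has_derivative:
  fixes y :: "real \<Rightarrow> 'a::real_inner"
  assumes "(y has_vector_derivative y') (at t within A)"
  shows "((\<lambda>t. (norm (y t))\<^sup>2) has_real_derivative 2 * (y t \<bullet> y')) (at t within A)"
  using bounded_bilinear.has_vector_derivative[OF bounded_bilinear_inner assms assms]
  by (simp add: power2_norm_eq_inner has_real_derivative_iff_has_vector_derivative inner_commute)

text \<open>With \<open>\<rho>\<close> the square of \<open>r\<close> and \<open>q\<close> the
  squared distance, this derivative produces exactly the gain of the controller.\<close>

lemma fraction_has_derivative:
  fixes q :: "real \<Rightarrow> real"
  assumes "(q has_real_derivative q') (at t within A)" "\<rho> - q t \<noteq> 0"
  shows "((\<lambda>t. q t / (\<rho> - q t)) has_real_derivative \<rho> * q' / (\<rho> - q t)\<^sup>2) (at t within A)"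
  using assms by (auto intro!: derivative_eq_intros simp: power2_eq_square algebra_simps)

text \<open>The strict bound \<open>start\<close> keeps the initial state off the pole of the gain:
  the hysteresis rule alone allows an edge of length exactly \<open>r\<close>.\<close>

locale closed_loop = hysteresis_graph +
  fixes l :: nat and T1 :: real and c :: "nat \<Rightarrow> real^2" and b :: "nat \<Rightarrow> real"
    and u :: "nat \<Rightarrow> real \<Rightarrow> real^2"
  assumes T1: "0 \<le> T1"
    and start: "(i, j) \<in> E T1 \<Longrightarrow> d i j T1 < r"
    and leader: "l \<in> {1..N}" "i \<in> {1..N} \<Longrightarrow> b i = (if i = l then 1 else 0)"
    and dynamics: "single_integrator N T1 x u"
    and feedback: "i \<in> {1..N} \<Longrightarrow> T1 \<le> t \<Longrightarrow> u i t = controller N r c b E x i t"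
begin

text \<open>Weighted adjacency matrix. The zero entries let all sums run over the fixed index set,
  so that the graph enters only through the weights.\<close>

definition w :: "nat \<Rightarrow> nat \<Rightarrow> real \<Rightarrow> real" where
  "w i j t = (if (i, j) \<in> E t then 2 * r\<^sup>2 / (r\<^sup>2 - (d i j t)\<^sup>2)\<^sup>2 else 0)"

lemma w_sym: "0 \<le> t \<Longrightarrow> i \<in> {1..N} \<Longrightarrow> j \<in> {1..N} \<Longrightarrow> w i j t = w j i t"
  using edge_sym[of i j t] edge_sym[of j i t] by (auto simp: w_def d_commute[of i j])

lemma coupling_eq:
  assumes "i \<in> {1..N}" "T1 \<le> t"
  shows "(\<Sum>j\<in>{1..N}. w i j t *\<^sub>R (x i t - x j t)) = - u i t - b i *\<^sub>R (x i t - c i)"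
proof -
  have "(\<Sum>j\<in>{1..N}. w i j t *\<^sub>R (x i t - x j t)) =
      (\<Sum>j\<in>{1..N}. if (i, j) \<in> E t
        then (2 * r\<^sup>2 / (r\<^sup>2 - (d i j t)\<^sup>2)\<^sup>2) *\<^sub>R (x i t - x j t) else 0)"
    by (intro sum.cong) (auto simp: w_def)
  also have "\<dots> = (\<Sum>j\<in>neighbours N E i t.
      (2 * r\<^sup>2 / (r\<^sup>2 - (d i j t)\<^sup>2)\<^sup>2) *\<^sub>R (x i t - x j t))"
    unfolding neighbours_def by (rule sum.inter_filter[symmetric]) simp
  finally show ?thesis
    using feedback[OF assms] by (simp add: controller_def d_def)
qed

lemma sum_leader: "(\<Sum>i\<in>{1..N}. b i * g i) = g l"
proof -
  have "(\<Sum>i\<in>{1..N}. b i * g i) = (\<Sum>i\<in>{1..N}. if i = l then g i else 0)"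
    using leader(2) by (intro sum.cong) auto
  then show ?thesis using leader(1) by simp
qed

text \<open>The closed-loop equation tested against arbitrary vectors \<open>v i\<close>. The choice
  \<open>v i = u i t\<close> gives the decay of the potential, \<open>v i = x i t - c l\<close> that
  of the squared distances to the goal.\<close>

lemma coupling_sum:
  assumes "T1 \<le> t"
  shows "(\<Sum>i\<in>{1..N}. \<Sum>j\<in>{1..N}. w i j t * ((x i t - x j t) \<bullet> (v i - v j))) =
    - 2 * (\<Sum>i\<in>{1..N}. u i t \<bullet> v i) - 2 * ((x l t - c l) \<bullet> v l)"
proof -
  have "(\<Sum>i\<in>{1..N}. (\<Sum>j\<in>{1..N}. w i j t *\<^sub>R (x i t - x j t)) \<bullet> v i) =
      (\<Sum>i\<in>{1..N}. - (u i t \<bullet> v i) - b i * ((x i t - c i) \<bullet> v i))"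
    by (intro sum.cong refl) (simp only: coupling_eq[OF _ assms] inner_diff_left inner_minus_left
        inner_scaleR_left)
  also have "\<dots> = - (\<Sum>i\<in>{1..N}. u i t \<bullet> v i) - (x l t - c l) \<bullet> v l"
    using sum_leader[of "\<lambda>i. (x i t - c i) \<bullet> v i"] by (simp add: sum_subtractf sum_negf)
  finally show ?thesis
    using assms T1 by (subst sum_symmetrize) (simp_all add: w_sym)
qed

text \<open>Uniting the exceptional sets of the finitely many agents allows sums over agents to be
  differentiated off one countable set.\<close>

lemma velocities:
  obtains S where "countable S" "\<And>i a e t. i \<in> {1..N} \<Longrightarrow> T1 \<le> a \<Longrightarrow> t \<in> {a..e} - S \<Longrightarrow>
    (x i has_vector_derivative u i t) (at t within {a..e})"
proof -
  have "\<forall>i\<in>{1..N}. \<exists>S. countable S \<and>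
      (\<forall>t\<in>{T1..} - S. (x i has_vector_derivative u i t) (at t within {T1..}))"
    using dynamics by (simp add: single_integrator_def)
  then obtain S where S: "\<And>i. i \<in> {1..N} \<Longrightarrow> countable (S i)"
    "\<And>i t. i \<in> {1..N} \<Longrightarrow> t \<in> {T1..} - S i \<Longrightarrow>
      (x i has_vector_derivative u i t) (at t within {T1..})"
    by metis
  show ?thesis
  proof (rule that[of "\<Union>i\<in>{1..N}. S i"])
    show "countable (\<Union>i\<in>{1..N}. S i)" using S(1) by auto
    fix i a e t assume "i \<in> {1..N}" "T1 \<le> a" "t \<in> {a..e} - (\<Union>i\<in>{1..N}. S i)"
    then show "(x i has_vector_derivative u i t) (at t within {a..e})"
      by (intro has_vector_derivative_within_subset[OF S(2)]) auto
  qed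
qed

section \<open>The potential and the preservation of edges\<close>

text \<open>The edge set is a parameter rather than \<open>E t\<close>, so a new edge causes no
  jump. Ordered pairs count every edge twice.\<close>

definition potential :: "(nat \<times> nat) set \<Rightarrow> real \<Rightarrow> real" where
  "potential F t = (norm (x l t - c l))\<^sup>2 + (\<Sum>i\<in>{1..N}. \<Sum>j\<in>{1..N}.
     if (i, j) \<in> F then (d i j t)\<^sup>2 / (r\<^sup>2 - (d i j t)\<^sup>2) else 0)"

lemma distance_square_less: "d i j t < r \<Longrightarrow> (d i j t)\<^sup>2 < r\<^sup>2"
  by (intro power_strict_mono) (auto simp: d_def)

text \<open>The control is minus the gradient of half the potential, so the derivative is
  \<open>- 2 * (\<Sum>i. \<parallel>u i t\<parallel>\<^sup>2)\<close>.\<close>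

lemma potential_nonincreasing:
  assumes "T1 \<le> a" "a \<le> e"
    and E: "\<And>t. t \<in> {a..e} \<Longrightarrow> E t = F"
    and close: "\<And>i j t. t \<in> {a..e} \<Longrightarrow> (i, j) \<in> F \<Longrightarrow> d i j t < r"
  shows "potential F e \<le> potential F a"
proof -
  obtain S where S: "countable S" and vel: "\<And>i t. i \<in> {1..N} \<Longrightarrow> t \<in> {a..e} - S \<Longrightarrow>
      (x i has_vector_derivative u i t) (at t within {a..e})"
    by (rule velocities, rule that) (use assms(1) in auto)
  define V' where "V' t = 2 * ((x l t - c l) \<bullet> u l t) +
    (\<Sum>i\<in>{1..N}. \<Sum>j\<in>{1..N}. w i j t * ((x i t - x j t) \<bullet> (u i t - u j t)))" for t
  have "potential F e - potential F a \<le> 0 * (e - a)"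
  proof (rule increment_le_of_derivative_le[OF S assms(2), where f' = V'])
    have "continuous_on {a..e} (x i)" if "i \<in> {1..N}" for i
      using cont[OF that] by (rule continuous_on_subset) (use assms(1) T1 in auto)
    moreover have "continuous_on {a..e} (d i j)" if "i \<in> {1..N}" "j \<in> {1..N}" for i j
      using d_continuous[OF that] by (rule continuous_on_subset) (use assms(1) T1 in auto)
    moreover have "r\<^sup>2 - (d i j t)\<^sup>2 \<noteq> 0" if "t \<in> {a..e}" "(i, j) \<in> F" for i j t
      using distance_square_less[OF close[OF that]] by simp
    moreover have "continuous_on {a..e}
        (\<lambda>t. if (i, j) \<in> F then (d i j t)\<^sup>2 / (r\<^sup>2 - (d i j t)\<^sup>2) else 0)"
      if "i \<in> {1..N}" "j \<in> {1..N}" for i j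
      using calculation(2)[OF that] calculation(3)
      by (cases "(i, j) \<in> F") (auto intro!: continuous_intros)
    ultimately show "continuous_on {a..e} (potential F)"
      unfolding potential_def using leader(1)
      by (intro continuous_intros continuous_on_sum) auto
    fix t assume t: "t \<in> {a..e} - S"
    have diff: "((\<lambda>t. (d i j t)\<^sup>2) has_real_derivative 2 * ((x i t - x j t) \<bullet> (u i t - u j t)))
        (at t within {a..e})" if "i \<in> {1..N}" "j \<in> {1..N}" for i j
      unfolding d_def by (intro norm_sq_has_derivative has_vector_derivative_diff vel that t)
    have pair: "((\<lambda>t. if (i, j) \<in> F then (d i j t)\<^sup>2 / (r\<^sup>2 - (d i j t)\<^sup>2) else 0)
        has_real_derivative w i j t * ((x i t - x j t) \<bullet> (u i t - u j t))) (at t within {a..e})"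
      if ij: "i \<in> {1..N}" "j \<in> {1..N}" for i j
    proof (cases "(i, j) \<in> F")
      case True
      have nz: "r\<^sup>2 - (d i j t)\<^sup>2 \<noteq> 0" using distance_square_less[OF close, of t i j] True t by simp
      then show ?thesis
        using fraction_has_derivative[OF diff[OF ij] nz] True t by (simp add: w_def E mult_ac)
    qed (use t in \<open>simp add: w_def E\<close>)
    have "((\<lambda>t. (norm (x l t - c l))\<^sup>2) has_real_derivative 2 * ((x l t - c l) \<bullet> (u l t - 0)))
        (at t within {a..e})"
      by (intro norm_sq_has_derivative has_vector_derivative_diff vel leader(1) t
          has_vector_derivative_const)
    then show "(potential F has_real_derivative V' t) (at t within {a..e})"
      unfolding potential_def V'_def by (intro DERIV_add DERIV_sum pair) simp_all
    \<comment> \<open>\<open>coupling_sum\<close> with the velocities as test vectors; the two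
      leader terms cancel.\<close>
    have "V' t = - 2 * (\<Sum>i\<in>{1..N}. u i t \<bullet> u i t)"
      unfolding V'_def using t assms(1) by (subst coupling_sum) auto
    then show "V' t \<le> 0" by (simp add: sum_nonneg)
  qed
  then show ?thesis by simp
qed

text \<open>All summands are nonnegative, so each is at most \<open>K\<close>, and clearing the
  denominator gives the claim. In this form the bound is a closed condition and survives limits in
  \<open>t\<close>.\<close>

lemma potential_bounds_distance:
  assumes F: "F \<subseteq> {1..N} \<times> {1..N}" "\<And>i j. (i, j) \<in> F \<Longrightarrow> d i j t < r"
    and ij: "(i, j) \<in> F" and K: "potential F t \<le> K"
  shows "(1 + K) * (d i j t)\<^sup>2 \<le> K * r\<^sup>2"
proof -
  define g where "g i j = (if (i, j) \<in> F then (d i j t)\<^sup>2 / (r\<^sup>2 - (d i j t)\<^sup>2) else 0)" for i j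
  have nonneg: "0 \<le> g i j" for i j
    using distance_square_less[OF F(2), of i j] by (auto simp: g_def intro!: divide_nonneg_pos)
  have in_range: "i \<in> {1..N}" "j \<in> {1..N}" using F(1) ij by auto
  have "g i j \<le> (\<Sum>j\<in>{1..N}. g i j)"
    using in_range nonneg by (intro member_le_sum) auto
  also have "\<dots> \<le> (\<Sum>i\<in>{1..N}. \<Sum>j\<in>{1..N}. g i j)"
    using in_range nonneg by (intro member_le_sum[of i "{1..N}" "\<lambda>i. \<Sum>j\<in>{1..N}. g i j"]
        sum_nonneg) auto
  also have "\<dots> \<le> K"
    using K zero_le_power2[of "norm (x l t - c l)"] unfolding potential_def g_def by linarith
  finally have "g i j \<le> K" .
  then show ?thesis
    using ij distance_square_less[OF F(2)[OF ij]] by (simp add: g_def field_simps)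
qed

text \<open>At \<open>\<tau>\<close> itself the graph may differ from \<open>F\<close>, so the bound is passed to the limit from the left.\<close>

lemma distance_at_end:
  assumes "T1 \<le> T" "T < \<tau>"
    and E: "\<And>t. T \<le> t \<Longrightarrow> t < \<tau> \<Longrightarrow> E t = F"
    and close: "\<And>i j t. T \<le> t \<Longrightarrow> t < \<tau> \<Longrightarrow> (i, j) \<in> F \<Longrightarrow> d i j t < r"
    and ij: "(i, j) \<in> F"
  shows "d i j \<tau> < r"
proof -
  define K where "K = potential F T"
  have F: "F \<subseteq> {1..N} \<times> {1..N}" using edge_subset[of T] E[of T] assms(1,2) T1 by simp
  then have in_range: "i \<in> {1..N}" "j \<in> {1..N}" using ij by auto
  have K: "0 \<le> K" unfolding K_def potential_def
    using distance_square_less[OF close[of T]] assms(2)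
    by (intro add_nonneg_nonneg sum_nonneg) (auto intro!: divide_nonneg_pos)
  have bound: "(1 + K) * (d i j t)\<^sup>2 \<le> K * r\<^sup>2" if "T \<le> t" "t < \<tau>" for t
    using potential_nonincreasing[of T t F] E close that assms(1)
    by (intro potential_bounds_distance[OF F _ ij]) (auto simp: K_def)
  have "isCont (d i j) \<tau>"
    using d_continuous[OF in_range] assms(1,2) T1 by (intro continuous_on_interior[of "{0..}"]) auto
  then have "(d i j \<longlongrightarrow> d i j \<tau>) (at_left \<tau>)"
    by (simp add: continuous_within filterlim_at_split isCont_def)
  then have "((\<lambda>t. (1 + K) * (d i j t)\<^sup>2) \<longlongrightarrow> (1 + K) * (d i j \<tau>)\<^sup>2) (at_left \<tau>)"
    by (intro tendsto_intros)
  moreover have "\<forall>\<^sub>F t in at_left \<tau>. (1 + K) * (d i j t)\<^sup>2 \<le> K * r\<^sup>2"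
    using eventually_at_left_real[OF assms(2)] by eventually_elim (auto intro: bound)
  ultimately have "(1 + K) * (d i j \<tau>)\<^sup>2 \<le> K * r\<^sup>2"
    by (intro tendsto_upperbound) auto
  \<comment> \<open>The limit preserves only a weak inequality; the gap between \<open>K\<close> and
    \<open>1 + K\<close> makes it strict again.\<close>
  also have "\<dots> < (1 + K) * r\<^sup>2" using eps by (simp add: algebra_simps)
  finally have "(d i j \<tau>)\<^sup>2 < r\<^sup>2" using K by simp
  then show ?thesis by (rule power2_less_imp_less) (use eps in simp)
qed

text \<open>Between two changes of the graph the potential keeps every edge shorter than \<open>r\<close>, so edges are
  only gained, which can happen finitely often.\<close>

lemma edges_preserved:
  assumes "T1 \<le> T" "\<And>i j. (i, j) \<in> E T \<Longrightarrow> d i j T < r" "T \<le> t"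
  shows "E T \<subseteq> E t \<and> (\<forall>(i, j)\<in>E t. d i j t < r)"
  using assms
\<comment> \<open>Induction on the number of missing pairs, restarted at the time of each change of
  the graph.\<close>
proof (induction "card ({1..N} \<times> {1..N} - E T)" arbitrary: T rule: less_induct)
  case less
  define good where "good t \<longleftrightarrow> E t = E T \<and> (\<forall>(i, j)\<in>E t. d i j t < r)" for t
  show ?case
  proof (cases "\<forall>s. T \<le> s \<longrightarrow> good s")
    case True
    then have "good t" using less.prems(3) by blast
    then show ?thesis by (simp add: good_def)
  next
    case False
    define B where "B = {s. T \<le> s \<and> \<not> good s}"
    \<comment> \<open>The infimum need not lie in \<open>B\<close>; comparing
      \<open>E \<tau>\<close> with \<open>E T\<close> below decides whether the failure occurs at
      \<open>\<tau>\<close> itself.\<close>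
    define \<tau> where "\<tau> = Inf B"
    have B: "B \<noteq> {}" "bdd_below B" using False by (auto simp: B_def)
    have T\<tau>: "T \<le> \<tau>" unfolding \<tau>_def using B by (intro cInf_greatest) (auto simp: B_def)
    have before: "good s" if "T \<le> s" "s < \<tau>" for s
      using cInf_lower[of s B] B(2) that by (auto simp: \<tau>_def B_def not_le[symmetric])
    have \<tau>0: "0 \<le> \<tau>" "T1 \<le> \<tau>" using T\<tau> less.prems(1) T1 by auto
    have old: "(i, j) \<in> E \<tau> \<and> d i j \<tau> < r" if "(i, j) \<in> E T" for i j
    proof (cases "T = \<tau>")
      case True
      then show ?thesis using that less.prems(2) by simp
    next
      case False
      then have "T < \<tau>" using T\<tau> by simp
      \<comment> \<open>\<open>edge_persists\<close> needs the distance bound at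
        \<open>\<tau>\<close> too, where the graph is not yet known to contain
        \<open>E T\<close>.\<close>
      have lt: "d i j \<tau> < r"
      proof (rule distance_at_end[OF less.prems(1) \<open>T < \<tau>\<close>])
        show "E s = E T" if "T \<le> s" "s < \<tau>" for s
          using before[OF that] by (simp only: good_def)
        show "d i' j' s < r" if "T \<le> s" "s < \<tau>" "(i', j') \<in> E T" for i' j' s
          using before[OF that(1,2)] that(3) unfolding good_def by auto
        show "(i, j) \<in> E T" by fact
      qed
      have ij: "i \<in> {1..N}" "j \<in> {1..N}" using that edge_subset[of T] less.prems(1) T1 by auto
      have "d i j s \<le> r" if "T < s" "s \<le> \<tau>" for s
        using before[of s] lt that \<open>(i, j) \<in> E T\<close>
        by (cases "s = \<tau>") (force simp: good_def)+
      then have "(i, j) \<in> E \<tau>"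
        using edge_persists[OF ij, of T \<tau>] that T\<tau> less.prems(1) T1 by simp
      then show ?thesis using lt by simp
    qed
    \<comment> \<open>A gained edge of length at least \<open>r\<close> could exist only by
      hysteresis, hence already just before \<open>\<tau>\<close>, when the graph was still
      \<open>E T\<close>.\<close>
    have new: "d i j \<tau> < r" if "(i, j) \<in> E \<tau>" "(i, j) \<notin> E T" for i j
    proof (rule ccontr)
      assume n: "\<not> d i j \<tau> < r"
      have "T < \<tau>" using that T\<tau> by (cases "T = \<tau>") auto
      have ij: "i \<in> {1..N}" "j \<in> {1..N}" using that edge_subset[of \<tau>] \<tau>0 by auto
      have "\<forall>\<^sub>F s in at_left \<tau>. (i, j) \<in> E s"
        using edge_iff[OF ij, of \<tau>] that n eps \<open>T < \<tau>\<close> less.prems(1) T1 by auto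
      moreover have "\<forall>\<^sub>F s in at_left \<tau>. (i, j) \<notin> E s"
        using eventually_at_left_real[OF \<open>T < \<tau>\<close>]
      proof eventually_elim
        case (elim s)
        then show ?case using before[of s] that(2) by (simp add: good_def)
      qed
      ultimately have "\<forall>\<^sub>F s in at_left \<tau>. False" by eventually_elim simp
      then show False by simp
    qed
    have close: "d i j \<tau> < r" if "(i, j) \<in> E \<tau>" for i j
      using old new that by blast
    have sub: "E T \<subseteq> E \<tau>" using old by auto
    show ?thesis
    proof (cases "E \<tau> = E T")
      \<comment> \<open>With no change at \<open>\<tau>\<close>, \<open>edge_const_right\<close>
        keeps all times \<open>good\<close> beyond \<open>\<tau>\<close>, contradicting the choice
        of the infimum.\<close>
      case True
      have "\<forall>\<^sub>F s in at_right \<tau>. good s"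
        using edge_const_right[of \<tau>] \<tau>0 close True unfolding good_def by auto
      then obtain e where e: "\<tau> < e" "\<And>s. \<tau> < s \<Longrightarrow> s < e \<Longrightarrow> good s"
        unfolding eventually_at_right_field by blast
      have "good \<tau>" using True close by (auto simp: good_def)
      have "e \<le> s" if "s \<in> B" for s
        using before[of s] e(2)[of s] \<open>good \<tau>\<close> that
        by (cases s \<tau> rule: linorder_cases) (auto simp: B_def not_le[symmetric])
      then have "e \<le> \<tau>" unfolding \<tau>_def using B by (intro cInf_greatest) auto
      then show ?thesis using e by simp
    next
      case False
      show ?thesis
      proof (cases "t < \<tau>")
        case True
        then show ?thesis using before[of t] less.prems(3) by (auto simp: good_def)
      next
        case nlt: False
        have "card ({1..N} \<times> {1..N} - E \<tau>) < card ({1..N} \<times> {1..N} - E T)"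
          using sub False edge_subset[of \<tau>] \<tau>0 by (intro psubset_card_mono) auto
        then have "E \<tau> \<subseteq> E t \<and> (\<forall>(i, j)\<in>E t. d i j t < r)"
          using less.hyps[of \<tau>] \<tau>0 close nlt by simp
        then show ?thesis using sub by auto
      qed
    qed
  qed
qed

section \<open>Convergence to the goal region\<close>

definition disagreement :: "real \<Rightarrow> real" where
  "disagreement t = (norm (x l t - c l))\<^sup>2 +
     (\<Sum>i\<in>{1..N}. \<Sum>j\<in>{1..N}. if (i, j) \<in> E T1 then (d i j t)\<^sup>2 else 0)"

text \<open>Unlike the potential, \<open>\<Sum>i. \<parallel>x i t - c l\<parallel>\<^sup>2\<close> does not involve the graph and has no jumps.\<close>

lemma disagreement_small:
  assumes "0 < \<eta>"
  shows "\<exists>t\<ge>T1. disagreement t < \<eta>"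
proof (rule ccontr)
  assume "\<not> ?thesis"
  then have large: "\<eta> \<le> disagreement t" if "T1 \<le> t" for t using that by force
  \<comment> \<open>The factor 2 belongs to the leader term of the decay;
    \<open>2 / r\<^sup>2\<close> is the smallest gain, attained at distance 0.\<close>
  define \<kappa> where "\<kappa> = min 2 (2 / r\<^sup>2)"
  have \<kappa>: "0 < \<kappa>" using eps by (simp add: \<kappa>_def)
  define Q where "Q t = (\<Sum>i\<in>{1..N}. (norm (x i t - c l))\<^sup>2)" for t
  define Q' where "Q' t = (\<Sum>i\<in>{1..N}. 2 * ((x i t - c l) \<bullet> u i t))" for t
  \<comment> \<open>Chosen so that decay at rate \<open>\<kappa> * \<eta>\<close> would bring
    \<open>Q\<close> down to \<open>-1\<close> or less at time \<open>e\<close>.\<close>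
  define e where "e = T1 + (Q T1 + 1) / (\<kappa> * \<eta>)"
  have Q: "0 \<le> Q t" for t by (simp add: Q_def sum_nonneg)
  have "T1 \<le> e" using Q[of T1] \<kappa> assms by (simp add: e_def)
  obtain S where S: "countable S" and vel: "\<And>i t. i \<in> {1..N} \<Longrightarrow> t \<in> {T1..e} - S \<Longrightarrow>
      (x i has_vector_derivative u i t) (at t within {T1..e})"
    by (rule velocities, rule that) auto
  have "Q e - Q T1 \<le> - (\<kappa> * \<eta>) * (e - T1)"
  proof (rule increment_le_of_derivative_le[OF S \<open>T1 \<le> e\<close>, where f' = Q'])
    have "continuous_on {T1..e} (x i)" if "i \<in> {1..N}" for i
      using cont[OF that] by (rule continuous_on_subset) (use T1 in auto)
    then show "continuous_on {T1..e} Q"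
      unfolding Q_def by (intro continuous_intros) auto
    fix t assume t: "t \<in> {T1..e} - S"
    have "((\<lambda>t. (norm (x i t - c l))\<^sup>2) has_real_derivative 2 * ((x i t - c l) \<bullet> (u i t - 0)))
        (at t within {T1..e})" if "i \<in> {1..N}" for i
      by (intro norm_sq_has_derivative has_vector_derivative_diff vel that t
          has_vector_derivative_const)
    then show "(Q has_real_derivative Q' t) (at t within {T1..e})"
      unfolding Q_def Q'_def by (intro DERIV_sum) simp_all
    have pres: "E T1 \<subseteq> E t" "\<And>i j. (i, j) \<in> E t \<Longrightarrow> d i j t < r"
      using edges_preserved[of T1 t] start t by auto
    \<comment> \<open>Edges of \<open>E T1\<close> are still present and have gain at least
      \<open>\<kappa>\<close>; edges gained later contribute nonnegative terms on the right
      only.\<close>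
    have weight: "(if (i, j) \<in> E T1 then \<kappa> * (d i j t)\<^sup>2 else 0) \<le> w i j t * (d i j t)\<^sup>2" for i j
    proof (cases "(i, j) \<in> E T1")
      case True
      then have lt: "(d i j t)\<^sup>2 < r\<^sup>2" and e: "(i, j) \<in> E t" using pres distance_square_less by auto
      have "(r\<^sup>2 - (d i j t)\<^sup>2)\<^sup>2 \<le> (r\<^sup>2)\<^sup>2" using lt by (intro power_mono) auto
      moreover have "0 < (r\<^sup>2 - (d i j t)\<^sup>2)\<^sup>2" using lt by simp
      ultimately have "2 * r\<^sup>2 / (r\<^sup>2)\<^sup>2 \<le> 2 * r\<^sup>2 / (r\<^sup>2 - (d i j t)\<^sup>2)\<^sup>2"
        using eps by (intro divide_left_mono mult_pos_pos) auto
      moreover have "2 * r\<^sup>2 / (r\<^sup>2)\<^sup>2 = 2 / r\<^sup>2" by (simp add: power2_eq_square)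
      ultimately have "\<kappa> \<le> w i j t" using e by (simp add: w_def \<kappa>_def)
      then show ?thesis using True by (simp add: mult_right_mono)
    qed (simp add: w_def)
    \<comment> \<open>Subtracting \<open>c l\<close> from both positions leaves their difference
      unchanged and puts the sum into the form of \<open>coupling_sum\<close>.\<close>
    have "(\<Sum>i\<in>{1..N}. \<Sum>j\<in>{1..N}. w i j t * (d i j t)\<^sup>2) =
        (\<Sum>i\<in>{1..N}. \<Sum>j\<in>{1..N}.
          w i j t * ((x i t - x j t) \<bullet> ((x i t - c l) - (x j t - c l))))"
      by (simp add: d_def power2_norm_eq_inner)
    also have "\<dots> = - Q' t - 2 * (norm (x l t - c l))\<^sup>2"
      using t by (subst coupling_sum)
        (auto simp: Q'_def sum_distrib_left sum_negf power2_norm_eq_inner inner_commute[of "u _ t"])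
    finally have Q'_eq: "Q' t = - 2 * (norm (x l t - c l))\<^sup>2 -
        (\<Sum>i\<in>{1..N}. \<Sum>j\<in>{1..N}. w i j t * (d i j t)\<^sup>2)" by simp
    have "\<kappa> * (\<Sum>i\<in>{1..N}. \<Sum>j\<in>{1..N}. if (i, j) \<in> E T1 then (d i j t)\<^sup>2 else 0) =
        (\<Sum>i\<in>{1..N}. \<Sum>j\<in>{1..N}. if (i, j) \<in> E T1 then \<kappa> * (d i j t)\<^sup>2 else 0)"
      unfolding sum_distrib_left by (intro sum.cong) auto
    also have "\<dots> \<le> (\<Sum>i\<in>{1..N}. \<Sum>j\<in>{1..N}. w i j t * (d i j t)\<^sup>2)"
      by (intro sum_mono weight)
    moreover have "\<kappa> * (norm (x l t - c l))\<^sup>2 \<le> 2 * (norm (x l t - c l))\<^sup>2"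
      by (intro mult_right_mono) (auto simp: \<kappa>_def)
    ultimately have "\<kappa> * disagreement t \<le> - Q' t"
      unfolding Q'_eq disagreement_def distrib_left by linarith
    moreover have "\<kappa> * \<eta> \<le> \<kappa> * disagreement t"
      using large[of t] t \<kappa> by (intro mult_left_mono) auto
    ultimately show "Q' t \<le> - (\<kappa> * \<eta>)" by simp
  qed
  also have "\<dots> = - (Q T1 + 1)" using \<kappa> assms by (simp add: e_def)
  finally show False using Q[of e] by simp
qed

lemma reaches_ball:
  assumes conn: "graph_connected N (E T1)" and "0 < \<rho>"
  shows "\<exists>t\<ge>T1. \<forall>i\<in>{1..N}. norm (x i t - c l) \<le> \<rho>"
proof -
  \<comment> \<open>A walk to the leader has at most \<open>card (E T1)\<close> edges of length at
    most \<open>s\<close>, and the leader's own distance to the goal adds one more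
    \<open>s\<close>.\<close>
  define s where "s = \<rho> / (1 + real (card (E T1)))"
  have s: "0 < s" using assms(2) by (simp add: s_def add_pos_nonneg)
  then obtain t where t: "T1 \<le> t" "disagreement t < s\<^sup>2"
    using disagreement_small[of "s\<^sup>2"] by auto
  define g where "g i j = (if (i, j) \<in> E T1 then (d i j t)\<^sup>2 else 0)" for i j
  have g: "0 \<le> g i j" for i j by (simp add: g_def)
  have dis: "disagreement t = (norm (x l t - c l))\<^sup>2 + (\<Sum>i\<in>{1..N}. \<Sum>j\<in>{1..N}. g i j)"
    by (simp add: disagreement_def g_def)
  have "(norm (x l t - c l))\<^sup>2 \<le> s\<^sup>2"
  proof -
    have "0 \<le> (\<Sum>i\<in>{1..N}. \<Sum>j\<in>{1..N}. g i j)" by (intro sum_nonneg g)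
    then show ?thesis using t(2) unfolding dis by linarith
  qed
  then have near: "norm (x l t - c l) \<le> s" using s by (simp add: power2_le_iff_abs_le)
  have sub: "E T1 \<subseteq> {1..N} \<times> {1..N}" using edge_subset T1 by simp
  have edge: "norm (x i t - x j t) \<le> s" if "(i, j) \<in> E T1" for i j
  proof -
    have ij: "i \<in> {1..N}" "j \<in> {1..N}" using that sub by auto
    have "g i j \<le> (\<Sum>j\<in>{1..N}. g i j)" using ij g by (intro member_le_sum) auto
    also have "\<dots> \<le> (\<Sum>i\<in>{1..N}. \<Sum>j\<in>{1..N}. g i j)"
      using ij g by (intro member_le_sum[of i "{1..N}" "\<lambda>i. \<Sum>j\<in>{1..N}. g i j"] sum_nonneg) auto
    also have "\<dots> \<le> s\<^sup>2" using t(2) zero_le_power2[of "norm (x l t - c l)"]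
      unfolding dis by linarith
    finally show ?thesis using that s by (simp add: g_def d_def power2_le_iff_abs_le)
  qed
  have "norm (x i t - c l) \<le> \<rho>" if "i \<in> {1..N}" for i
  proof -
    have "(i, l) \<in> (E T1)\<^sup>*" using conn that leader(1) by (simp add: graph_connected_def)
    moreover have "finite (E T1)" using sub by (rule finite_subset) simp
    ultimately obtain n where n: "n \<le> card (E T1)" "(i, l) \<in> E T1 ^^ n"
      by (auto simp: rtrancl_finite_eq_relpow)
    have "norm (x i t - c l) \<le> norm (x i t - x l t) + norm (x l t - c l)"
      using norm_triangle_ineq[of "x i t - x l t" "x l t - c l"] by simp
    also have "\<dots> \<le> real n * s + s"
      using relpow_norm_le[of "E T1" "\<lambda>i. x i t" s, OF edge n(2)] near by simp
    also have "\<dots> \<le> real (card (E T1)) * s + s" using n(1) s by simp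
    also have "\<dots> = (1 + real (card (E T1))) * s" by (simp add: algebra_simps)
    also have "\<dots> = \<rho>" by (simp add: s_def add_pos_nonneg less_imp_neq[symmetric])
    finally show ?thesis .
  qed
  then show ?thesis using t(1) by blast
qed

end

theorem lemma2:
  fixes N l :: nat and r \<epsilon> T1 r_goal r_min :: real
    and x u :: "nat \<Rightarrow> real \<Rightarrow> real^2" and c :: "nat \<Rightarrow> real^2" and b :: "nat \<Rightarrow> real"
    and E :: "real \<Rightarrow> (nat \<times> nat) set"
  assumes "0 < \<epsilon>" and "\<epsilon> < r" and "0 \<le> T1"
    and "\<forall>i\<in>{1..N}. continuous_on {0..} (x i)"
    and "connectivity_graph N r \<epsilon> x E"
    and "graph_connected N (E T1)"
    and "\<forall>(i, j)\<in>E T1. norm (x i T1 - x j T1) < r"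
    and "l \<in> {1..N}"
    and "\<forall>i\<in>{1..N}. b i = (if i = l then 1 else 0)"
    and "0 < r_min" and "r_min \<le> r_goal"
    and "single_integrator N T1 x u"
    and "\<forall>i\<in>{1..N}. \<forall>t\<ge>T1. u i t = controller N r c b E x i t"
  shows "\<exists>t\<ge>T1. \<forall>i\<in>{1..N}. x i t \<in> cball (c l) r_goal"
proof -
  interpret hysteresis_graph N r \<epsilon> x E
    using assms by unfold_locales auto
  interpret closed_loop N r \<epsilon> x E l T1 c b u
    using assms by unfold_locales (auto simp: d_def)
  show ?thesis
    using reaches_ball[OF assms(6), of r_goal] assms(10,11)
    by (simp add: dist_norm norm_minus_commute)
qed

end
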